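(* Assume that $f:\mathbb{N}\to(0,\infty)$ is bounded from above and from below, i.e. there is a constant $c>0$ with $c\le f(n)\le 1/c$ for all $n\in\mathbb{N}$, and that $S_n/n\to 0$ as $n\to\infty$. For all $n\ge0$, conditionally on $\mathcal{T}_n$, let $V_n$ be a uniform random vertex of $\mathcal{T}_n$. Then $$\frac{d(V_n)}{\log n}\longrightarrow 1\quad\text{in probability as } n\to\infty.$$ More precisely, for all $\varepsilon>0$, almost surely, the number of vertices of $\mathcal{T}_n$ at depth between $(1-\varepsilon)\log n$ and $(1+\varepsilon)\log n$ is equivalent to $n$ as $n\to\infty$ (i.e. its ratio to $n$ tends to $1$).
   Context: $\mathbb{N}=\{0,1,2,\dots\}$. For a rooted tree, the depth $d(v)$ of a vertex $v$ is its graph distance to the root. Given a weight function $f:\mathbb{N}\to(0,\infty)$, the sequence of depth-weighted random recursive trees $(\mathcal{T}_n)_{n\ge0}$ is defined as follows: $\mathcal{T}_0$ consists of a single (root) vertex $v_0$; given $\mathcal{T}_n$, a vertex of $\mathcal{T}_n$ is chosen with probability proportional to its weight, i.e. $v\in\mathcal{T}_n$ is chosen with probability $f(d(v))/\sum_{u\in\mathcal{T}_n}f(d(u))$, and $\mathcal{T}_{n+1}$ is obtained by attaching a new vertex $v_{n+1}$ to the chosen vertex. $S_0=0$ and $S_n=\sum_{k=0}^{n-1}\log f(k)$. *)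

theory Defs
  imports "HOL-Probability.Probability"
begin

record 'v rooted_graph =
  verts :: "'v set"
  edges :: "'v set set"
  root :: 'v

definition adj :: "('v, 'm) rooted_graph_scheme \<Rightarrow> ('v \<times> 'v) set" where
  "adj t = {(u, v). {u, v} \<in> edges t}"

text \<open>Graph distance to the root: the least length of a walk from the root to \<open>v\<close>.\<close>
definition depth :: "('v, 'm) rooted_graph_scheme \<Rightarrow> 'v \<Rightarrow> nat" where
  "depth t v = (LEAST k. (root t, v) \<in> adj t ^^ k)"

definition single_root :: "'v \<Rightarrow> 'v rooted_graph" where
  "single_root r = \<lparr>verts = {r}, edges = {}, root = r\<rparr>"

definition attach :: "'v rooted_graph \<Rightarrow> 'v \<Rightarrow> 'v \<Rightarrow> 'v rooted_graph" where
  "attach t v w = t\<lparr>verts := insert w (verts t), edges := insert {v, w} (edges t)\<rparr>"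

text \<open>
  The vertex \<open>v\<^sub>n\<close> is the number \<open>n\<close>. Since vertices are labelled by their time of arrival,
  \<open>T n\<close> determines \<open>T 0, \<dots>, T (n - 1)\<close> almost surely, so conditioning on \<open>T n\<close> is the same
  as conditioning on the whole past, and the assumptions determine the joint law of the sequence.
  In \<open>step\<close> the trees \<open>attach t v (Suc n)\<close> for different \<open>v \<in> verts t\<close> are distinct, so the
  event in the conditional probability says that \<open>v\<close> is the chosen vertex.
\<close>
locale depth_weighted_rrt = prob_space M
  for M :: "'a measure" and f :: "nat \<Rightarrow> real" and T :: "nat \<Rightarrow> 'a \<Rightarrow> nat rooted_graph" +
  assumes weight_pos: "\<And>k. f k > 0"
    and tree_measurable: "\<And>n. T n \<in> measurable M (count_space UNIV)"
    and initial: "AE \<omega> in M. T 0 \<omega> = single_root 0"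
    and step: "\<And>n t v. \<P>(\<omega> in M. T n \<omega> = t) > 0 \<Longrightarrow> v \<in> verts t \<Longrightarrow>
      \<P>(\<omega> in M. T (Suc n) \<omega> = attach t v (Suc n) \<bar> T n \<omega> = t)
        = f (depth t v) / (\<Sum>u\<in>verts t. f (depth t u))"

text \<open>Conditionally on the random tree \<open>X\<close>, the random vertex \<open>V\<close> is uniform on its vertices.\<close>
definition uniform_vertex_given ::
  "'a measure \<Rightarrow> ('a \<Rightarrow> nat rooted_graph) \<Rightarrow> ('a \<Rightarrow> nat) \<Rightarrow> bool" where
  "uniform_vertex_given M X V \<longleftrightarrow>
     V \<in> measurable M (count_space UNIV) \<and>
     (\<forall>t v. \<P>(\<omega> in M. X \<omega> = t) > 0 \<longrightarrow> v \<in> verts t \<longrightarrow>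
        \<P>(\<omega> in M. V \<omega> = v \<bar> X \<omega> = t) = 1 / real (card (verts t)))"

definition tendsto_in_probability ::
  "'a measure \<Rightarrow> (nat \<Rightarrow> 'a \<Rightarrow> real) \<Rightarrow> real \<Rightarrow> bool" where
  "tendsto_in_probability M X l \<longleftrightarrow>
     (\<forall>\<epsilon>>0. (\<lambda>n. \<P>(\<omega> in M. \<bar>X n \<omega> - l\<bar> > \<epsilon>)) \<longlonglongrightarrow> 0)"

end

theory Submission
  imports Defs "HOL-Real_Asymp.Real_Asymp"
begin

text \<open>
  Let \<open>d u\<close> be the depth of vertex \<open>u\<close>, \<open>w i\<close> the total weight of the \<open>i\<close>-th tree and
  \<open>A n = (\<Sum>i<n. 1 / w i)\<close>. The function \<open>g k = \<beta> ^ k / (\<Prod>j<k. f j)\<close> satisfies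
  \<open>f k * g (k + 1) = \<beta> * g k\<close>, so for \<open>m n = (\<Sum>u\<le>n. g (d u))\<close> the process
  \<open>m n * exp (- \<beta> * A n)\<close> is a supermartingale and hence almost surely bounded. Since
  \<open>S\<^sub>k = o(k)\<close>, \<open>g k\<close> behaves like \<open>\<beta> ^ k\<close> up to subexponential factors, and a Chernoff bound shows
  that few vertices have depth outside \<open>(1 \<plusminus> \<epsilon>) ln n\<close>, provided that \<open>A n \<le> (1 + o(1)) ln n\<close>.

  This last estimate is obtained without any second moments: if \<open>\<beta> < 1\<close>, then \<open>g \<le> G\<close> is bounded, and
  \<open>exp (\<beta> * B n) / m n\<close> with \<open>B n = (\<Sum>i<n. m i / (m i + G) / w i)\<close> is also a supermartingale.
  As \<open>m i \<ge> 1\<close>, its boundedness first gives \<open>m n \<longrightarrow> \<infinity>\<close>, so that \<open>B\<close> and \<open>A\<close> are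
  asymptotically equal, and then \<open>exp (\<beta> * B n) = O(m n) = O(n)\<close>.
\<close>

section \<open>Depths in recursive trees\<close>

text \<open>\<open>depth\<close> is a \<open>LEAST\<close> and says nothing unless some walk exists;
  this invariant supplies one. Keeping edges inside \<open>verts\<close> ensures that a fresh vertex
  is isolated before it is attached.\<close>

definition walk_connected :: "('v, 'm) rooted_graph_scheme \<Rightarrow> bool" where
  "walk_connected t \<longleftrightarrow> root t \<in> verts t \<and> \<Union>(edges t) \<subseteq> verts t \<and>
     (\<forall>v\<in>verts t. \<exists>k. (root t, v) \<in> adj t ^^ k)"

lemma depth_walk:
  assumes "walk_connected t" "v \<in> verts t"
  shows "(root t, v) \<in> adj t ^^ depth t v"
  using assms unfolding walk_connected_def depth_def by (metis LeastI)

lemma depth_le: "(root t, v) \<in> adj t ^^ k \<Longrightarrow> depth t v \<le> k"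
  unfolding depth_def by (rule Least_le)

lemma attach_sel [simp]:
  "verts (attach t v w) = insert w (verts t)"
  "edges (attach t v w) = insert {v, w} (edges t)"
  "root (attach t v w) = root t"
  by (simp_all add: attach_def)

lemma adj_attach_mono: "adj t ^^ k \<subseteq> adj (attach t v w) ^^ k"
  by (induction k) (auto simp: adj_def)

context
  fixes t :: "'v rooted_graph" and v w :: 'v
  assumes t: "walk_connected t" and v: "v \<in> verts t" and w: "w \<notin> verts t"
begin

text \<open>A walk may pass through the new leaf \<open>w\<close>, but it can only enter from
  \<open>v\<close> and return to \<open>v\<close>, so the detour gives no shortcut. Both bounds are
  proved together; the strict one at \<open>w\<close> pays for the step back to
  \<open>v\<close>.\<close>

lemma walk_attach:
  assumes "(root t, x) \<in> adj (attach t v w) ^^ k"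
  shows "(x \<in> verts t \<longrightarrow> depth t x \<le> k) \<and> (x = w \<longrightarrow> depth t v < k)"
  using assms
proof (induction k arbitrary: x)
  case 0
  then have "x = root t" by simp
  moreover have "depth t (root t) \<le> 0" by (rule depth_le) simp
  ultimately show ?case
    using t w by (auto simp: walk_connected_def)
next
  case (Suc k)
  then obtain y where y: "(root t, y) \<in> adj (attach t v w) ^^ k" "{y, x} = {v, w} \<or> {y, x} \<in> edges t"
    by (auto simp: adj_def)
  consider "y = v" "x = w" | "y = w" "x = v" | "{y, x} \<in> edges t"
    using y(2) by (auto simp: doubleton_eq_iff)
  then show ?case
  proof cases
    case 3
    then have "y \<in> verts t" "x \<in> verts t"
      using t by (auto simp: walk_connected_def)
    moreover have "(root t, x) \<in> adj t ^^ Suc (depth t y)"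
      using depth_walk[OF t \<open>y \<in> verts t\<close>] 3 by (auto simp: adj_def)
    ultimately show ?thesis
      using depth_le Suc.IH[OF y(1)] w by fastforce
  qed (use Suc.IH[OF y(1)] v w in auto)
qed

lemma depth_attach_new: "depth (attach t v w) w = Suc (depth t v)"
proof (rule antisym)
  have "(root t, w) \<in> adj (attach t v w) ^^ Suc (depth t v)"
    using depth_walk[OF t v] adj_attach_mono[where t = t and v = v and w = w] by (auto simp: adj_def)
  then show "depth (attach t v w) w \<le> Suc (depth t v)"
    using depth_le[of "attach t v w" w] by simp
  then show "Suc (depth t v) \<le> depth (attach t v w) w"
    using walk_attach[of w] \<open>(root t, w) \<in> _\<close>
    unfolding depth_def[of "attach t v w"] attach_sel by (metis (mono_tags, lifting) LeastI Suc_leI)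
qed

lemma depth_attach_old:
  assumes "x \<in> verts t"
  shows "depth (attach t v w) x = depth t x"
proof (rule antisym)
  have *: "(root t, x) \<in> adj (attach t v w) ^^ depth t x"
    using depth_walk[OF t assms] adj_attach_mono[where t = t and v = v and w = w] by auto
  then show "depth (attach t v w) x \<le> depth t x"
    using depth_le[of "attach t v w" x] by simp
  then show "depth t x \<le> depth (attach t v w) x"
    using walk_attach[of x] * assms
    unfolding depth_def[of "attach t v w"] attach_sel by (metis (mono_tags, lifting) LeastI)
qed

lemma walk_connected_attach: "walk_connected (attach t v w)"
proof -
  have "\<exists>k. (root t, x) \<in> adj (attach t v w) ^^ k" if "x \<in> verts t" for x
    using depth_walk[OF t that] adj_attach_mono[where t = t and v = v and w = w] by blast
  moreover from this[OF v] have "\<exists>k. (root t, w) \<in> adj (attach t v w) ^^ k"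
  proof
    fix k assume "(root t, v) \<in> adj (attach t v w) ^^ k"
    then have "(root t, w) \<in> adj (attach t v w) ^^ Suc k"
      by (auto simp: adj_def)
    then show ?thesis ..
  qed
  ultimately show ?thesis
    using t v by (auto simp: walk_connected_def)
qed

end

text \<open>These finite sets carry the law of \<open>T n\<close>, so every expectation below
  becomes a finite sum.\<close>

primrec recursive_trees :: "nat \<Rightarrow> nat rooted_graph set" where
  "recursive_trees 0 = {single_root 0}"
| "recursive_trees (Suc n) = (\<Union>t\<in>recursive_trees n. (\<lambda>v. attach t v (Suc n)) ` verts t)"

lemma recursive_tree:
  assumes "t \<in> recursive_trees n"
  shows "walk_connected t \<and> verts t = {..n} \<and> root t = 0"
  using assms
proof (induction n arbitrary: t)
  case 0
  then show ?case
    by (auto simp: single_root_def walk_connected_def intro: exI[of _ 0])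
next
  case (Suc n)
  then obtain s v where s: "s \<in> recursive_trees n" "v \<in> verts s" "t = attach s v (Suc n)"
    by auto
  moreover note Suc.IH[OF s(1)]
  ultimately show ?case
    by (auto intro!: walk_connected_attach)
qed

lemma finite_recursive_trees: "finite (recursive_trees n)"
  by (induction n) (auto simp: recursive_tree)

text \<open>No old edge contains \<open>w\<close>, so the parent can be read off from the unique
  edge at \<open>w\<close>. This makes the events of choosing different parents disjoint.\<close>

lemma inj_on_attach:
  assumes "walk_connected t" "w \<notin> verts t"
  shows "inj_on (\<lambda>v. attach t v w) (verts t)"
proof
  fix u v assume uv: "u \<in> verts t" "v \<in> verts t" "attach t u w = attach t v w"
  have "{u, w} \<notin> edges t"
    using assms by (auto simp: walk_connected_def)
  moreover have "{u, w} \<in> insert {v, w} (edges t)"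
    using arg_cong[OF uv(3), of edges] by auto
  ultimately show "u = v"
    using uv assms(2) by (auto simp: doubleton_eq_iff)
qed

section \<open>Supermartingale functionals of a depth sequence\<close>

definition total_weight :: "(nat \<Rightarrow> real) \<Rightarrow> (nat \<Rightarrow> nat) \<Rightarrow> nat \<Rightarrow> real" where
  "total_weight f d n = (\<Sum>u\<le>n. f (d u))"

text \<open>All functionals here depend on a plain depth sequence, which separates the analysis from
  the probability. \<open>clock\<close> compensates the growth of \<open>mass\<close>: on average a
  step multiplies \<open>mass\<close> by \<open>1 + \<beta> / total_weight f d n\<close>.\<close>

definition clock :: "(nat \<Rightarrow> real) \<Rightarrow> (nat \<Rightarrow> nat) \<Rightarrow> nat \<Rightarrow> real" where
  "clock f d n = (\<Sum>i<n. 1 / total_weight f d i)"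

definition tilt :: "(nat \<Rightarrow> real) \<Rightarrow> real \<Rightarrow> nat \<Rightarrow> real" where
  "tilt f \<beta> k = \<beta> ^ k / (\<Prod>j<k. f j)"

definition mass :: "(nat \<Rightarrow> real) \<Rightarrow> real \<Rightarrow> (nat \<Rightarrow> nat) \<Rightarrow> nat \<Rightarrow> real" where
  "mass f \<beta> d n = (\<Sum>u\<le>n. tilt f \<beta> (d u))"

text \<open>The damping factor \<open>mass / (mass + G)\<close> accounts for the nonlinearity of
  \<open>1 / mass\<close> when increments of \<open>mass\<close> are at most
  \<open>G\<close>.\<close>

definition slow_clock :: "(nat \<Rightarrow> real) \<Rightarrow> real \<Rightarrow> real \<Rightarrow> (nat \<Rightarrow> nat) \<Rightarrow> nat \<Rightarrow> real" where
  "slow_clock f \<beta> G d n =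
     (\<Sum>i<n. mass f \<beta> d i / (mass f \<beta> d i + G) / total_weight f d i)"

lemma eventually_le_imp_bounded:
  fixes x :: "nat \<Rightarrow> real"
  assumes "\<forall>\<^sub>F k in sequentially. x k \<le> 1"
  shows "\<exists>C>0. \<forall>k. x k \<le> C"
proof -
  obtain N where N: "\<And>k. k \<ge> N \<Longrightarrow> x k \<le> 1"
    using assms by (auto simp: eventually_sequentially)
  let ?C = "1 + (\<Sum>k<N. \<bar>x k\<bar>)"
  have "x k \<le> ?C" for k
  proof (cases "k < N")
    case True
    then have "\<bar>x k\<bar> \<le> (\<Sum>k<N. \<bar>x k\<bar>)"
      by (intro member_le_sum) auto
    then show ?thesis by linarith
  next
    case False
    then have "x k \<le> 1" by (simp add: N)
    moreover have "0 \<le> (\<Sum>k<N. \<bar>x k\<bar>)" by (simp add: sum_nonneg)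
    ultimately show ?thesis by linarith
  qed
  moreover have "?C > 0" by (simp add: add_pos_nonneg sum_nonneg)
  ultimately show ?thesis by blast
qed

lemma clock_Suc: "clock f d (Suc n) = clock f d n + 1 / total_weight f d n"
  by (simp add: clock_def)

lemma tilt_0 [simp]: "tilt f \<beta> 0 = 1"
  by (simp add: tilt_def)

lemma mass_Suc: "mass f \<beta> d (Suc n) = mass f \<beta> d n + tilt f \<beta> (d (Suc n))"
  by (simp add: mass_def)

lemma slow_clock_Suc: "slow_clock f \<beta> G d (Suc n) =
  slow_clock f \<beta> G d n + mass f \<beta> d n / (mass f \<beta> d n + G) / total_weight f d n"
  by (simp add: slow_clock_def)

lemma total_weight_cong: "(\<And>u. u \<le> n \<Longrightarrow> d u = d' u) \<Longrightarrow> total_weight f d n = total_weight f d' n"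
  by (simp add: total_weight_def)

lemma mass_cong: "(\<And>u. u \<le> n \<Longrightarrow> d u = d' u) \<Longrightarrow> mass f \<beta> d n = mass f \<beta> d' n"
  by (simp add: mass_def)

lemma clock_cong: "(\<And>u. u < n \<Longrightarrow> d u = d' u) \<Longrightarrow> clock f d n = clock f d' n"
  unfolding clock_def by (intro sum.cong refl arg_cong2[of _ _ _ _ "(/)"] total_weight_cong) auto

lemma slow_clock_cong:
  assumes "\<And>u. u < n \<Longrightarrow> d u = d' u"
  shows "slow_clock f \<beta> G d n = slow_clock f \<beta> G d' n"
proof -
  have "mass f \<beta> d i = mass f \<beta> d' i" "total_weight f d i = total_weight f d' i" if "i < n" for i
    using assms that by (auto intro!: mass_cong total_weight_cong)
  then show ?thesis
    by (simp add: slow_clock_def)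
qed

context
  fixes f :: "nat \<Rightarrow> real"
  assumes f_pos: "\<And>k. f k > 0"
begin

lemma total_weight_pos: "total_weight f d n > 0"
  unfolding total_weight_def by (intro sum_pos) (auto simp: f_pos)

lemma tilt_pos: "\<beta> > 0 \<Longrightarrow> tilt f \<beta> k > 0"
  by (simp add: tilt_def prod_pos f_pos)

lemma tilt_Suc: "f k * tilt f \<beta> (Suc k) = \<beta> * tilt f \<beta> k"
  using f_pos[of k] by (simp add: tilt_def field_simps)

lemma tilt_eq_exp:
  assumes "\<beta> > 0"
  shows "tilt f \<beta> k = exp (real k * ln \<beta> - (\<Sum>j<k. ln (f j)))"
  using assms f_pos
  by (simp add: tilt_def exp_diff exp_sum exp_of_nat_mult)

lemma mass_pos: "\<beta> > 0 \<Longrightarrow> mass f \<beta> d n > 0"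
  unfolding mass_def by (intro sum_pos) (auto simp: tilt_pos)

lemma weighted_tilt: "(\<Sum>v\<le>n. f (d v) * tilt f \<beta> (Suc (d v))) = \<beta> * mass f \<beta> d n"
  by (simp add: tilt_Suc mass_def sum_distrib_left)

text \<open>
  Given depths \<open>d 0, \<dots>, d n\<close>, the next vertex has depth \<open>d v + 1\<close> with probability
  \<open>f (d v) / total_weight f d n\<close>; the supermartingale inequalities are multiplied by the total weight.
\<close>
lemma mass_supermartingale:
  assumes "\<beta> > 0"
  defines "X \<equiv> \<lambda>n d. mass f \<beta> d n * exp (- \<beta> * clock f d n)"
  shows "(\<Sum>v\<le>n. f (d v) * X (Suc n) (d(Suc n := Suc (d v)))) \<le> total_weight f d n * X n d"
proof -
  let ?w = "total_weight f d n" and ?M = "mass f \<beta> d n"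
  let ?E = "exp (- \<beta> * clock f d (Suc n))"
  \<comment> \<open>The clock at \<open>Suc n\<close> sums only up to index \<open>n\<close>, so it
    is already determined before the new vertex arrives.\<close>
  have "clock f (d(Suc n := k)) (Suc n) = clock f d (Suc n)" for k
    by (intro clock_cong) auto
  moreover have "mass f \<beta> (d(Suc n := k)) (Suc n) = ?M + tilt f \<beta> k" for k
    unfolding mass_Suc by (auto intro: mass_cong)
  ultimately have "X (Suc n) (d(Suc n := k)) = (?M + tilt f \<beta> k) * ?E" for k
    by (simp add: X_def)
  then have "(\<Sum>v\<le>n. f (d v) * X (Suc n) (d(Suc n := Suc (d v))))
      = (\<Sum>v\<le>n. f (d v) * ?M + f (d v) * tilt f \<beta> (Suc (d v))) * ?E"
    by (simp only: sum_distrib_right) (simp add: algebra_simps)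
  also have "\<dots> = (?w * ?M + \<beta> * ?M) * ?E"
    by (simp only: sum.distrib weighted_tilt) (simp add: total_weight_def sum_distrib_right)
  also have "\<dots> = ?w * (?M * (1 + \<beta> / ?w) * ?E)"
    using total_weight_pos[of d n] by (simp add: field_simps)
  \<comment> \<open>By \<open>1 + x \<le> exp x\<close> the mean growth factor is absorbed by
    exactly one increment of the clock.\<close>
  also have "\<dots> \<le> ?w * (?M * exp (\<beta> / ?w) * ?E)"
    using total_weight_pos[of d n] mass_pos[of \<beta> d n] assms
    by (intro mult_left_mono mult_right_mono exp_ge_add_one_self) auto
  also have "?M * exp (\<beta> / ?w) * ?E = X n d"
    by (simp add: X_def clock_Suc algebra_simps flip: exp_add)
  finally show ?thesis .
qed

text \<open>Averaging a linear upper bound for \<open>1 / (M + g)\<close> gives the factor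
  \<open>1 - \<beta> * (M / (M + G) / w)\<close>, at most the exponential of minus
  \<open>\<beta>\<close> times the slow clock increment. Boundedness of this process will bound
  \<open>mass\<close> from below.\<close>

lemma inverse_mass_supermartingale:
  assumes "\<beta> > 0" and G: "\<And>k. tilt f \<beta> k \<le> G"
  defines "Y \<equiv> \<lambda>n d. exp (\<beta> * slow_clock f \<beta> G d n) / mass f \<beta> d n"
  shows "(\<Sum>v\<le>n. f (d v) * Y (Suc n) (d(Suc n := Suc (d v)))) \<le> total_weight f d n * Y n d"
proof -
  let ?w = "total_weight f d n" and ?M = "mass f \<beta> d n"
  let ?E = "exp (\<beta> * slow_clock f \<beta> G d (Suc n))"
  have w: "?w > 0" and M: "?M > 0"
    using total_weight_pos mass_pos assms by auto
  have Gpos: "G > 0"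
    using G[of 0] by simp
  have slow: "slow_clock f \<beta> G (d(Suc n := k)) (Suc n) = slow_clock f \<beta> G d (Suc n)" for k
    by (intro slow_clock_cong) auto
  have mass: "mass f \<beta> (d(Suc n := k)) (Suc n) = ?M + tilt f \<beta> k" for k
    unfolding mass_Suc by (auto intro: mass_cong)
  \<comment> \<open>The exact identity has \<open>?M + tilt f \<beta> k\<close> in the last
    denominator; enlarging it to \<open>?M + G\<close> leaves a bound linear in the tilt, so that
    \<open>weighted_tilt\<close> applies.\<close>
  have bound: "1 / (?M + tilt f \<beta> k) \<le> 1 / ?M - tilt f \<beta> k / (?M * (?M + G))" for k
  proof -
    have t: "tilt f \<beta> k > 0" using assms tilt_pos by auto
    have "1 / (?M + tilt f \<beta> k) = 1 / ?M - tilt f \<beta> k / (?M * (?M + tilt f \<beta> k))"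
      using M t by (simp add: divide_simps)
    also have "\<dots> \<le> 1 / ?M - tilt f \<beta> k / (?M * (?M + G))"
      using M t G[of k] Gpos
      by (intro diff_left_mono divide_left_mono mult_left_mono mult_pos_pos add_pos_pos) auto
    finally show ?thesis .
  qed
  have "(\<Sum>v\<le>n. f (d v) * Y (Suc n) (d(Suc n := Suc (d v))))
      = ?E * (\<Sum>v\<le>n. f (d v) * (1 / (?M + tilt f \<beta> (Suc (d v)))))"
    unfolding Y_def slow mass by (simp add: sum_distrib_left algebra_simps)
  also have "\<dots> \<le> ?E * (\<Sum>v\<le>n. f (d v) * (1 / ?M - tilt f \<beta> (Suc (d v)) / (?M * (?M + G))))"
    using bound f_pos by (intro mult_left_mono sum_mono) (auto simp: less_imp_le)
  also have "(\<Sum>v\<le>n. f (d v) * (1 / ?M - tilt f \<beta> (Suc (d v)) / (?M * (?M + G))))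
      = ?w * (1 / ?M) - \<beta> * ?M / (?M * (?M + G))"
    by (simp add: right_diff_distrib sum_subtractf total_weight_def sum_distrib_right
        weighted_tilt flip: sum_divide_distrib weighted_tilt)
  also have "\<dots> = ?w * (1 / ?M * (1 + - (\<beta> * (?M / (?M + G) / ?w))))"
    using w M Gpos add_pos_pos[OF M Gpos] by (simp add: divide_simps)
  also have "?E * (?w * (1 / ?M * (1 + - (\<beta> * (?M / (?M + G) / ?w)))))
      \<le> ?E * (?w * (1 / ?M * exp (- (\<beta> * (?M / (?M + G) / ?w)))))"
    using w M by (intro mult_left_mono exp_ge_add_one_self) auto
  also have "\<dots> = ?w * (1 / ?M * (?E * exp (- (\<beta> * (?M / (?M + G) / ?w)))))"
    by simp
  also have "1 / ?M * (?E * exp (- (\<beta> * (?M / (?M + G) / ?w)))) = Y n d"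
    by (simp add: Y_def slow_clock_Suc algebra_simps flip: exp_add)
  finally show ?thesis .
qed

end

section \<open>Growth of a depth sequence\<close>

context
  fixes f :: "nat \<Rightarrow> real"
  assumes f_pos: "\<And>k. f k > 0"
    and mean_ln: "(\<lambda>n. (\<Sum>k<n. ln (f k)) / real n) \<longlonglongrightarrow> 0"
begin

lemma tilt_exp_limit:
  assumes "\<beta> > 0"
  shows "(\<lambda>k. (real k * ln \<beta> - (\<Sum>j<k. ln (f j))) / real k) \<longlonglongrightarrow> ln \<beta>"
proof -
  have "(\<lambda>k. ln \<beta> - (\<Sum>j<k. ln (f j)) / real k) \<longlonglongrightarrow> ln \<beta> - 0"
    by (intro tendsto_diff tendsto_const mean_ln)
  moreover have "\<forall>\<^sub>F k in sequentially. ln \<beta> - (\<Sum>j<k. ln (f j)) / real k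
      = (real k * ln \<beta> - (\<Sum>j<k. ln (f j))) / real k"
    using eventually_gt_at_top[of 0] by eventually_elim (simp add: diff_divide_distrib)
  ultimately show ?thesis
    by (simp add: tendsto_cong)
qed

text \<open>Since the sums of \<open>ln (f j)\<close> are sublinear, \<open>tilt f \<beta> k\<close>
  has exponential rate \<open>ln \<beta>\<close>. Any larger rate dominates eventually, and
  \<open>C\<close> covers the finitely many remaining \<open>k\<close>.\<close>

lemma tilt_upper:
  assumes "\<beta> > 0" "ln \<beta> < \<theta>"
  shows "\<exists>C>0. \<forall>k. tilt f \<beta> k \<le> C * exp (\<theta> * real k)"
proof -
  have "\<forall>\<^sub>F k in sequentially. tilt f \<beta> k / exp (\<theta> * real k) \<le> 1"
    using order_tendstoD(2)[OF tilt_exp_limit[OF assms(1)] assms(2)] eventually_gt_at_top[of 0]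
    by eventually_elim
      (use f_pos in \<open>simp add: tilt_eq_exp[OF _ assms(1)] divide_le_eq pos_divide_less_eq\<close>)
  from eventually_le_imp_bounded[OF this] show ?thesis
    by (simp add: divide_le_eq)
qed

lemma tilt_lower:
  assumes "\<beta> > 0" "\<theta> < ln \<beta>"
  shows "\<exists>C>0. \<forall>k. exp (\<theta> * real k) \<le> C * tilt f \<beta> k"
proof -
  have "\<forall>\<^sub>F k in sequentially. exp (\<theta> * real k) / tilt f \<beta> k \<le> 1"
    using order_tendstoD(1)[OF tilt_exp_limit[OF assms(1)] assms(2)] eventually_gt_at_top[of 0]
    by eventually_elim
      (use f_pos in \<open>simp add: tilt_eq_exp[OF _ assms(1)] divide_le_eq pos_less_divide_eq\<close>)
  from eventually_le_imp_bounded[OF this] show ?thesis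
    using tilt_pos[OF f_pos assms(1)] by (simp add: divide_le_eq)
qed

section \<open>Growth estimates for one fixed depth sequence with bounded supermartingales\<close>

context
  fixes d :: "nat \<Rightarrow> nat"
  assumes start: "d 0 = 0"
    and mass_upper: "\<And>\<beta>. \<beta> \<in> \<rat> \<Longrightarrow> \<beta> > 0 \<Longrightarrow>
      \<exists>C. \<forall>n. mass f \<beta> d n * exp (- \<beta> * clock f d n) \<le> C"
    and mass_lower: "\<And>\<beta> G. \<beta> \<in> \<rat> \<Longrightarrow> \<beta> > 0 \<Longrightarrow> (\<And>k. tilt f \<beta> k \<le> real G) \<Longrightarrow>
      \<exists>C. \<forall>n. exp (\<beta> * slow_clock f \<beta> (real G) d n) / mass f \<beta> d n \<le> C"
begin

lemma mass_le_exp_clock: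
  assumes "\<beta> \<in> \<rat>" "\<beta> > 0"
  obtains C where "C > 0" "\<And>n. mass f \<beta> d n \<le> C * exp (\<beta> * clock f d n)"
proof -
  obtain C where C: "\<And>n. mass f \<beta> d n * exp (- \<beta> * clock f d n) \<le> C"
    using mass_upper assms by blast
  have le: "mass f \<beta> d n \<le> C * exp (\<beta> * clock f d n)" for n
    using C[of n] by (simp add: exp_minus divide_le_eq flip: divide_inverse)
  have "0 < mass f \<beta> d 0 * exp (- \<beta> * clock f d 0)"
    using mass_pos[OF f_pos assms(2)] by simp
  then have "C > 0"
    using C[of 0] by linarith
  with le that show thesis by blast
qed

lemma exp_slow_clock_le_mass:
  assumes "\<beta> \<in> \<rat>" "\<beta> > 0" "\<And>k. tilt f \<beta> k \<le> real G"
  obtains C where "C > 0" "\<And>n. exp (\<beta> * slow_clock f \<beta> (real G) d n) \<le> C * mass f \<beta> d n"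
proof -
  obtain C where C: "\<And>n. exp (\<beta> * slow_clock f \<beta> (real G) d n) / mass f \<beta> d n \<le> C"
    using mass_lower assms by blast
  have le: "exp (\<beta> * slow_clock f \<beta> (real G) d n) \<le> C * mass f \<beta> d n" for n
    using C[of n] mass_pos[OF f_pos assms(2)] by (simp add: divide_le_eq)
  have "0 < exp (\<beta> * slow_clock f \<beta> (real G) d 0) / mass f \<beta> d 0"
    using mass_pos[OF f_pos assms(2)] by simp
  then have "C > 0"
    using C[of 0] by linarith
  with le that show thesis by blast
qed

text \<open>For \<open>\<beta> = 2\<close> the rate \<open>0\<close> lies below \<open>ln 2\<close>,
  so the tilt is bounded away from zero and \<open>mass\<close> grows at least linearly. As
  \<open>mass\<close> is at most a multiple of \<open>exp (2 * clock)\<close>, the clock is at least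
  of order \<open>ln n\<close>.\<close>

lemma clock_at_top: "filterlim (clock f d) at_top sequentially"
proof -
  obtain C where C: "C > 0" "\<And>n. mass f 2 d n \<le> C * exp (2 * clock f d n)"
    using mass_le_exp_clock[of 2] by auto
  obtain c where c: "c > 0" "\<And>k. exp (0 * real k) \<le> c * tilt f 2 k"
    using tilt_lower[of 2 0] by auto
  have "ln (real n / (c * C)) / 2 \<le> clock f d n" if "n > 0" for n
  proof -
    have "real n \<le> (\<Sum>u\<le>n. exp (0 * real (d u)))" by simp
    also have "\<dots> \<le> c * mass f 2 d n"
      unfolding mass_def sum_distrib_left by (intro sum_mono c)
    also have "\<dots> \<le> c * (C * exp (2 * clock f d n))"
      using C c by (intro mult_left_mono) auto
    finally have "real n / (c * C) \<le> exp (2 * clock f d n)"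
      using C c by (simp add: divide_le_eq mult_ac)
    then have "ln (real n / (c * C)) \<le> 2 * clock f d n"
      using that C c by (metis divide_pos_pos exp_gt_zero ln_exp ln_le_cancel_iff mult_pos_pos
          of_nat_0_less_iff)
    then show ?thesis by simp
  qed
  then have "\<forall>\<^sub>F n in sequentially. ln (real n / (c * C)) / 2 \<le> clock f d n"
    using eventually_gt_at_top[of 0] by (rule eventually_mono[rotated])
  moreover have "filterlim (\<lambda>n. ln (real n / (c * C)) / 2) at_top sequentially"
    using c(1) C(1) by real_asymp
  ultimately show ?thesis
    by (rule filterlim_at_top_mono[rotated])
qed

text \<open>A bootstrap: a crude comparison with \<open>clock\<close> sends the slow clock to
  infinity, which forces \<open>mass\<close> to infinity, and then the damping factor tends to
  \<open>1\<close> and exceeds \<open>\<rho>\<close> from some index on.\<close>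

lemma slow_clock_ge:
  assumes "\<beta> \<in> \<rat>" "0 < \<beta>" "\<And>k. tilt f \<beta> k \<le> real G" "\<rho> < 1"
  obtains C where "\<forall>\<^sub>F n in sequentially. \<rho> * clock f d n - C \<le> slow_clock f \<beta> (real G) d n"
proof -
  let ?M = "mass f \<beta> d" and ?B = "slow_clock f \<beta> (real G) d" and ?w = "total_weight f d"
  have G: "real G \<ge> 1"
    using assms(3)[of 0] by simp
  have w: "?w n > 0" for n
    by (rule total_weight_pos) (rule f_pos)
  have M1: "?M n \<ge> 1" for n
  proof -
    have "tilt f \<beta> (d 0) \<le> ?M n"
      unfolding mass_def using tilt_pos[OF f_pos assms(2)]
      by (intro member_le_sum) (auto simp: less_imp_le)
    then show ?thesis by (simp add: start)
  qed
  have M_Gpos: "?M n + real G > 0" for n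
    using M1[of n] G by linarith
  \<comment> \<open>The root has depth \<open>0\<close> and tilt \<open>1\<close>, so
    \<open>mass\<close> is at least \<open>1\<close> and the damping factor at least
    \<open>1 / (1 + G)\<close>.\<close>
  have "clock f d n / (1 + real G) \<le> ?B n" for n
    unfolding clock_def slow_clock_def sum_divide_distrib
  proof (rule sum_mono)
    fix i
    have "?M i + real G \<le> ?M i * (1 + real G)"
      using mult_right_mono[OF M1[of i], of "real G"] by (simp add: distrib_left)
    then have "(?M i + real G) / ((?M i + real G) * (1 + real G))
        \<le> ?M i * (1 + real G) / ((?M i + real G) * (1 + real G))"
      using M_Gpos[of i] by (intro divide_right_mono) auto
    then have "1 / (1 + real G) \<le> ?M i / (?M i + real G)"
      using M_Gpos[of i] G by simp
    then have "1 / (1 + real G) / ?w i \<le> ?M i / (?M i + real G) / ?w i"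
      using w by (intro divide_right_mono) (auto simp: less_imp_le)
    then show "1 / ?w i / (1 + real G) \<le> ?M i / (?M i + real G) / ?w i"
      by (simp add: mult.commute)
  qed
  moreover have "filterlim (\<lambda>n. clock f d n / (1 + real G)) at_top sequentially"
    unfolding divide_inverse using G
    by (intro filterlim_at_top_mult_tendsto_pos[OF tendsto_const _ clock_at_top]) simp
  ultimately have B: "filterlim ?B at_top sequentially"
    by (auto intro: filterlim_at_top_mono)
  obtain C where C: "C > 0" "\<And>n. exp (\<beta> * ?B n) \<le> C * ?M n"
    using exp_slow_clock_le_mass assms(1-3) by metis
  \<comment> \<open>Divergence of \<open>?M\<close> is all that is wanted, so the exponential is
    weakened to a linear bound.\<close>
  have "?B n * (\<beta> / C) \<le> ?M n" for n
  proof -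
    have "\<beta> * ?B n \<le> exp (\<beta> * ?B n)"
      using exp_ge_add_one_self[of "\<beta> * ?B n"] by linarith
    then have "\<beta> * ?B n \<le> C * ?M n"
      using C(2)[of n] by linarith
    then show ?thesis
      using C(1) by (simp add: divide_le_eq mult_ac)
  qed
  moreover have "filterlim (\<lambda>n. ?B n * (\<beta> / C)) at_top sequentially"
    using assms(2) C(1) by (intro filterlim_at_top_mult_tendsto_pos[OF tendsto_const _ B]) simp
  ultimately have M: "filterlim ?M at_top sequentially"
    by (auto intro: filterlim_at_top_mono)
  have "((\<lambda>x. x / (x + real G)) \<longlongrightarrow> 1) at_top"
    by real_asymp
  then have "(\<lambda>n. ?M n / (?M n + real G)) \<longlonglongrightarrow> 1"
    using M by (rule filterlim_compose)
  then have "\<forall>\<^sub>F n in sequentially. \<rho> < ?M n / (?M n + real G)"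
    using assms(4) by (rule order_tendstoD)
  then obtain N where N: "\<And>n. n \<ge> N \<Longrightarrow> \<rho> < ?M n / (?M n + real G)"
    by (auto simp: eventually_sequentially)
  \<comment> \<open>From \<open>N\<close> on the increments are compared one by one; the subtracted
    constant discards the initial segment.\<close>
  have "\<rho> * clock f d n - \<rho> * clock f d N \<le> ?B n" if "n \<ge> N" for n
    using that
  proof (induction rule: dec_induct)
    case base
    have "?B N \<ge> 0"
      unfolding slow_clock_def using w M1 M_Gpos G
      by (intro sum_nonneg divide_nonneg_nonneg) (auto simp: less_imp_le intro: order_trans[OF _ M1])
    then show ?case by simp
  next
    case (step n)
    have "\<rho> * (1 / ?w n) \<le> ?M n / (?M n + real G) / ?w n"
      using divide_right_mono[OF less_imp_le[OF N[OF step(1)]] less_imp_le[OF w[of n]]] by simp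
    then show ?case
      using step(3) by (simp add: clock_Suc slow_clock_Suc algebra_simps)
  qed
  then show thesis
    by (intro that[of "\<rho> * clock f d N"] eventually_sequentiallyI)
qed

text \<open>For \<open>\<beta> < 1\<close> the tilt is bounded, so \<open>mass\<close> is at most
  linear in \<open>n\<close>. Taking logarithms in the lower bound for \<open>mass\<close> gives
  \<open>\<beta> * \<rho> * clock \<le> ln n + O(1)\<close>.\<close>

lemma clock_upper:
  assumes "s > 1"
  shows "\<forall>\<^sub>F n in sequentially. clock f d n \<le> s * ln (real n)"
proof -
  \<comment> \<open>Both \<open>\<beta>\<close> and then \<open>\<rho>\<close> are taken so close to
    \<open>1\<close> that \<open>s * \<beta> * \<rho> > 1\<close>; this slack absorbs the additive
    constants.\<close>
  obtain \<beta> where \<beta>: "\<beta> \<in> \<rat>" "1 / s < \<beta>" "\<beta> < 1"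
    using Rats_dense_in_real[of "1 / s" 1] assms by auto
  then have \<beta>_pos: "\<beta> > 0"
    using assms by (smt (verit) divide_pos_pos)
  obtain \<rho> where \<rho>: "1 / (s * \<beta>) < \<rho>" "\<rho> < 1"
    using dense[of "1 / (s * \<beta>)" 1] \<beta> assms by (auto simp: divide_less_eq mult.commute)
  then have \<rho>_pos: "\<rho> > 0"
    using assms \<beta>_pos by (smt (verit) divide_pos_pos mult_pos_pos)
  have gt1: "s * \<beta> * \<rho> > 1"
    using \<rho>(1) assms \<beta>_pos by (simp add: divide_less_eq mult_ac)
  obtain G0 where G0: "\<And>k. tilt f \<beta> k \<le> G0 * exp (0 * real k)"
    using tilt_upper[of \<beta> 0] \<beta> \<beta>_pos by (auto simp: ln_less_zero_iff)
  obtain G :: nat where "G0 \<le> real G"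
    using real_arch_simple by blast
  with G0 have G: "\<And>k. tilt f \<beta> k \<le> real G"
    by (auto intro: order_trans)
  have Gpos: "real G > 0"
    using G[of 0] by simp
  obtain K where K: "\<forall>\<^sub>F n in sequentially.
      \<rho> * clock f d n - K \<le> slow_clock f \<beta> (real G) d n"
    using slow_clock_ge[OF \<beta>(1) \<beta>_pos G \<rho>(2)] by blast
  obtain C where C: "C > 0" "\<And>n. exp (\<beta> * slow_clock f \<beta> (real G) d n) \<le> C * mass f \<beta> d n"
    using exp_slow_clock_le_mass[OF \<beta>(1) \<beta>_pos G] by blast
  have "(\<lambda>n. (ln (C * real G * (real n + 1)) + \<beta> * K) / ln (real n)) \<longlonglongrightarrow> 1"
    using C(1) Gpos by real_asymp
  from order_tendstoD(2)[OF this gt1] K eventually_gt_at_top[of 1]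
  show ?thesis
  proof eventually_elim
    case (elim n)
    have "mass f \<beta> d n \<le> real G * (real n + 1)"
      using sum_bounded_above[of "{..n}" "\<lambda>u. tilt f \<beta> (d u)" "real G"] G
      by (simp add: mass_def mult_ac algebra_simps)
    then have "exp (\<beta> * slow_clock f \<beta> (real G) d n) \<le> C * (real G * (real n + 1))"
      using C(2)[of n] C(1) by (meson mult_left_mono less_imp_le order_trans)
    then have "\<beta> * slow_clock f \<beta> (real G) d n \<le> ln (C * real G * (real n + 1))"
      using C(1) Gpos by (subst ln_ge_iff) (auto simp: mult_ac)
    moreover have "\<beta> * (\<rho> * clock f d n - K) \<le> \<beta> * slow_clock f \<beta> (real G) d n"
      using elim(2) \<beta>_pos by simp
    moreover have "ln (C * real G * (real n + 1)) + \<beta> * K < s * \<beta> * \<rho> * ln (real n)"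
      using elim(1,3) by (simp add: divide_less_eq)
    ultimately have "(\<beta> * \<rho>) * clock f d n \<le> (\<beta> * \<rho>) * (s * ln (real n))"
      by (simp add: algebra_simps)
    then show ?case
      using \<beta>_pos \<rho>_pos by simp
  qed
qed

text \<open>
  Exponential Markov inequality for the counting measure on the vertices. For \<open>\<beta>\<close> strictly between
  \<open>1\<close> and \<open>r\<close> the exponent \<open>\<theta> = 1 - 1 / \<beta>\<close> lies below \<open>ln \<beta>\<close>, while
  \<open>1 + \<theta> r - \<beta> = (\<beta> - 1) (r - \<beta>) / \<beta>\<close> is positive.
\<close>
lemma tail_fraction:
  assumes "\<beta> \<in> \<rat>" "\<beta> > 0" "(\<beta> - 1) * (r - \<beta>) > 0"
  shows "(\<lambda>n. real (card {u\<in>{..n}. (\<beta> - 1) * real (d u) \<ge> (\<beta> - 1) * (r * ln (real n))}) / real n)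
    \<longlonglongrightarrow> 0"
proof -
  define \<theta> where "\<theta> = 1 - 1 / \<beta>"
  have \<theta>: "\<theta> = (\<beta> - 1) / \<beta>"
    using assms(2) by (simp add: \<theta>_def field_simps)
  \<comment> \<open>Equality in \<open>ln x \<le> x - 1\<close> occurs only at \<open>x = 1\<close>,
    and \<open>\<beta> = 1\<close> is excluded by the sign hypothesis.\<close>
  have "ln (1 / \<beta>) < 1 / \<beta> - 1"
    using assms(2,3) ln_le_minus_one[of "1 / \<beta>"] ln_eq_minus_one[of "1 / \<beta>"]
    by (cases "ln (1 / \<beta>) = 1 / \<beta> - 1") auto
  then have "\<theta> < ln \<beta>"
    using assms(2) by (simp add: \<theta>_def ln_div)
  then obtain c where c: "c > 0" "\<And>k. exp (\<theta> * real k) \<le> c * tilt f \<beta> k"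
    using tilt_lower assms(2) by blast
  obtain C where C: "C > 0" "\<And>n. mass f \<beta> d n \<le> C * exp (\<beta> * clock f d n)"
    using mass_le_exp_clock assms(1,2) by blast
  have "\<beta> < 1 + \<theta> * r"
    using assms(2,3) by (simp add: \<theta> field_simps)
  \<comment> \<open>The gap between \<open>\<beta>\<close> and \<open>1 + \<theta> * r\<close>
    leaves room for the loss in \<open>clock_upper\<close>: with \<open>s = b / \<beta>\<close>,
    \<open>exp (\<beta> * clock f d n)\<close> is eventually at most \<open>n\<close> to the power
    \<open>b\<close>.\<close>
  then obtain b where b: "\<beta> < b" "b < 1 + \<theta> * r"
    using dense by blast
  define s where "s = b / \<beta>"
  have s: "s > 1" "\<beta> * s = b"
    using b assms(2) by (auto simp: s_def)
  \<comment> \<open>The factor \<open>\<beta> - 1\<close> treats both tails at once: for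
    \<open>\<beta> > 1\<close> this is the upper tail above \<open>r * ln n\<close>, for
    \<open>\<beta> < 1\<close> the lower tail below it.\<close>
  let ?A = "\<lambda>n. {u\<in>{..n}. (\<beta> - 1) * real (d u) \<ge> (\<beta> - 1) * (r * ln (real n))}"
  have "\<forall>\<^sub>F n in sequentially.
      norm (real (card (?A n)) / real n) \<le> c * C * exp ((b - 1 - \<theta> * r) * ln (real n))"
    using clock_upper[OF s(1)] eventually_gt_at_top[of 0]
  proof eventually_elim
    case (elim n)
    have "real (card (?A n)) * exp (\<theta> * (r * ln (real n))) = (\<Sum>u\<in>?A n. exp (\<theta> * (r * ln (real n))))"
      by simp
    also have "\<dots> \<le> (\<Sum>u\<in>?A n. exp (\<theta> * real (d u)))"
      using assms(2) by (intro sum_mono) (auto simp: \<theta> divide_right_mono)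
    also have "\<dots> \<le> (\<Sum>u\<le>n. exp (\<theta> * real (d u)))"
      by (intro sum_mono2) auto
    also have "\<dots> \<le> c * mass f \<beta> d n"
      unfolding mass_def sum_distrib_left by (intro sum_mono c)
    also have "\<dots> \<le> c * (C * exp (\<beta> * clock f d n))"
      using C c by (intro mult_left_mono) auto
    also have "\<dots> \<le> c * (C * exp (b * ln (real n)))"
      using C(1) c(1) assms(2) elim(1) by (simp add: mult.assoc flip: s(2))
    finally have "real (card (?A n)) \<le> c * C * exp (b * ln (real n)) * exp (- (\<theta> * (r * ln (real n))))"
      by (simp add: exp_minus pos_le_divide_eq mult.assoc flip: divide_inverse)
    then have "real (card (?A n)) / real n \<le>
        c * C * exp (b * ln (real n)) * exp (- (\<theta> * (r * ln (real n)))) * exp (- ln (real n))"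
      using divide_right_mono[of "real (card (?A n))" _ "real n"] elim(2)
      by (simp add: exp_minus divide_inverse mult_ac)
    also have "\<dots> = c * C * exp ((b - 1 - \<theta> * r) * ln (real n))"
      by (simp add: algebra_simps flip: exp_add)
    finally show ?case by simp
  qed
  moreover have "(\<lambda>n. c * C * exp ((b - 1 - \<theta> * r) * ln (real n))) \<longlonglongrightarrow> 0"
  proof -
    have "b - 1 - \<theta> * r < 0" using b by simp
    then show ?thesis by real_asymp
  qed
  ultimately show ?thesis
    by (rule Lim_null_comparison)
qed

lemma typical_fraction:
  assumes "\<epsilon> > 0"
  shows "(\<lambda>n. real (card {u\<in>{..n}. (1 - \<epsilon>) * ln (real n) \<le> real (d u) \<and>
    real (d u) \<le> (1 + \<epsilon>) * ln (real n)}) / real n) \<longlonglongrightarrow> 1"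
proof -
  obtain a where a: "a \<in> \<rat>" "1 < a" "a < 1 + \<epsilon>"
    using Rats_dense_in_real[of 1 "1 + \<epsilon>"] assms by auto
  \<comment> \<open>The maximum with \<open>0\<close> keeps \<open>b\<close> positive when
    \<open>\<epsilon> \<ge> 1\<close>.\<close>
  obtain b where b: "b \<in> \<rat>" "max 0 (1 - \<epsilon>) < b" "b < 1"
    using Rats_dense_in_real[of "max 0 (1 - \<epsilon>)" 1] assms by auto
  let ?g = "\<lambda>n. {u\<in>{..n}. (1 - \<epsilon>) * ln (real n) \<le> real (d u) \<and> real (d u) \<le> (1 + \<epsilon>) * ln (real n)}"
  let ?A = "\<lambda>\<beta> r n. {u\<in>{..n}. (\<beta> - 1) * real (d u) \<ge> (\<beta> - 1) * (r * ln (real n))}"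
  have high: "(\<lambda>n. real (card (?A a (1 + \<epsilon>) n)) / real n) \<longlonglongrightarrow> 0"
    using a by (intro tail_fraction) auto
  have low: "(\<lambda>n. real (card (?A b (1 - \<epsilon>) n)) / real n) \<longlonglongrightarrow> 0"
    using b by (intro tail_fraction mult_neg_neg) auto
  \<comment> \<open>The typical vertices and the two tails cover all \<open>n + 1\<close> vertices,
    and the tails are negligible.\<close>
  have lower: "real (Suc n) / real n - real (card (?A a (1 + \<epsilon>) n)) / real n
      - real (card (?A b (1 - \<epsilon>) n)) / real n \<le> real (card (?g n)) / real n" for n
  proof -
    have "{..n} \<subseteq> ?g n \<union> ?A a (1 + \<epsilon>) n \<union> ?A b (1 - \<epsilon>) n"
      using a(2) b(3) by auto
    then have "card {..n} \<le> card (?g n \<union> ?A a (1 + \<epsilon>) n \<union> ?A b (1 - \<epsilon>) n)"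
      by (intro card_mono) auto
    also have "\<dots> \<le> card (?g n) + card (?A a (1 + \<epsilon>) n) + card (?A b (1 - \<epsilon>) n)"
      by (meson add_le_mono1 card_Un_le order_trans)
    finally have "real (Suc n) \<le> real (card (?g n)) + real (card (?A a (1 + \<epsilon>) n))
        + real (card (?A b (1 - \<epsilon>) n))"
      by simp
    from divide_right_mono[OF this, of "real n"] show ?thesis
      by (simp add: add_divide_distrib)
  qed
  have upper: "real (card (?g n)) / real n \<le> real (Suc n) / real n" for n

  proof (intro divide_right_mono of_nat_mono)
    show "card (?g n) \<le> Suc n"
      using card_mono[of "{..n}" "?g n"] by auto
  qed simp
  have lim: "(\<lambda>n. real (Suc n) / real n) \<longlonglongrightarrow> 1"
    by real_asymp
  show ?thesis
  proof (rule tendsto_sandwich[OF always_eventually always_eventually])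
    show "(\<lambda>n. real (Suc n) / real n - real (card (?A a (1 + \<epsilon>) n)) / real n
      - real (card (?A b (1 - \<epsilon>) n)) / real n) \<longlonglongrightarrow> 1"
      using tendsto_diff[OF tendsto_diff[OF lim high] low] by simp
  qed (use lower upper lim in auto)
qed

end

end

section \<open>The random tree process\<close>

text \<open>The process frozen once it reaches level \<open>a\<close>, as in the proof of Doob's maximal inequality.\<close>
primrec stopped :: "(nat \<Rightarrow> (nat \<Rightarrow> nat) \<Rightarrow> real) \<Rightarrow> real \<Rightarrow> nat \<Rightarrow> (nat \<Rightarrow> nat) \<Rightarrow> real" where
  "stopped X a 0 d = X 0 d"
| "stopped X a (Suc n) d = (if stopped X a n d \<ge> a then stopped X a n d else X (Suc n) d)"

lemma stopped_nonneg: "(\<And>n d. X n d \<ge> 0) \<Longrightarrow> stopped X a n d \<ge> 0"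
  by (induction n) auto

lemma stopped_cong:
  assumes "\<And>n d d'. (\<And>u. u \<le> n \<Longrightarrow> d u = d' u) \<Longrightarrow> X n d = X n d'"
    and "\<And>u. u \<le> n \<Longrightarrow> d u = d' u"
  shows "stopped X a n d = stopped X a n d'"
  using assms(2)
proof (induction n)
  case 0
  then show ?case by (auto intro: assms(1))
next
  case (Suc n)
  then have "stopped X a n d = stopped X a n d'" "X (Suc n) d = X (Suc n) d'"
    by (auto intro: assms(1))
  then show ?case by simp
qed

lemma stopped_eq: "stopped X a n d < a \<Longrightarrow> stopped X a n d = X n d"
  by (cases n) (auto split: if_splits)

lemma stopped_ge_mono: "m \<le> n \<Longrightarrow> stopped X a m d \<ge> a \<Longrightarrow> stopped X a n d \<ge> a"
  by (induction rule: dec_induct) auto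

section \<open>Almost sure structure of the tree sequence\<close>

context depth_weighted_rrt
begin

text \<open>Reading the depth at arrival yields one random sequence for all \<open>n\<close>; later
  trees agree with it almost surely because attaching a leaf preserves old depths.\<close>

definition arrival_depth :: "nat \<Rightarrow> 'a \<Rightarrow> nat" where
  "arrival_depth u \<omega> = depth (T u \<omega>) u"

lemma tree_event: "{\<omega> \<in> space M. T n \<omega> \<in> A} \<in> events"
proof -
  have "T n -` A \<inter> space M \<in> events"
    using tree_measurable by (rule measurable_sets) auto
  then show ?thesis
    by (simp add: vimage_def Int_def conj_commute)
qed

lemma tree_eq_event: "{\<omega> \<in> space M. T n \<omega> = t} \<in> events"
  using tree_event[of n "{t}"] by simp

lemma step_event: "{\<omega> \<in> space M. T n \<omega> = t \<and> T (Suc n) \<omega> = s} \<in> events"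
proof -
  have "{\<omega> \<in> space M. T n \<omega> = t \<and> T (Suc n) \<omega> = s}
      = {\<omega> \<in> space M. T n \<omega> = t} \<inter> {\<omega> \<in> space M. T (Suc n) \<omega> = s}"
    by auto
  then show ?thesis
    using tree_eq_event by auto
qed

lemma measurable_tree_fun: "(\<lambda>\<omega>. F (T n \<omega>)) \<in> borel_measurable M"
  using measurable_compose[OF tree_measurable, of F borel n] by simp

lemma prob_step:
  assumes "t \<in> recursive_trees n" "v \<le> n"
  shows "\<P>(\<omega> in M. T n \<omega> = t \<and> T (Suc n) \<omega> = attach t v (Suc n))
    = \<P>(\<omega> in M. T n \<omega> = t) * (f (depth t v) / total_weight f (depth t) n)"
proof (cases "\<P>(\<omega> in M. T n \<omega> = t) = 0")
  case True
  have "\<P>(\<omega> in M. T n \<omega> = t \<and> T (Suc n) \<omega> = attach t v (Suc n)) \<le> \<P>(\<omega> in M. T n \<omega> = t)"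
    by (intro finite_measure_mono) (auto intro: tree_eq_event)
  then show ?thesis
    using True by (simp add: measure_le_0_iff)
next
  case False
  then have "\<P>(\<omega> in M. T n \<omega> = t) > 0"
    by (simp add: zero_less_measure_iff)
  moreover have "verts t = {..n}"
    using recursive_tree assms by blast
  ultimately show ?thesis
    using step[of n t v] assms False
    by (simp add: cond_prob_def total_weight_def conj_commute field_simps)
qed

lemma tree_weight_pos: "total_weight f d n > 0"
  by (rule total_weight_pos) (rule weight_pos)

lemma sum_attach_prob:
  "(\<Sum>v\<le>n. f (depth t v) / total_weight f (depth t) n) = 1"
  using tree_weight_pos[where d = "depth t" and n = n]
  by (simp add: total_weight_def flip: sum_divide_distrib)

text \<open>The model prescribes only conditional probabilities. The attachments to different
  parents are disjoint and their probabilities sum to that of \<open>T n = t\<close>, so any other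
  successor has probability zero.\<close>

lemma AE_step_from:
  assumes t: "t \<in> recursive_trees n"
  shows "AE \<omega> in M. T n \<omega> = t \<longrightarrow> (\<exists>v\<le>n. T (Suc n) \<omega> = attach t v (Suc n))"
proof -
  let ?E = "\<lambda>v. {\<omega> \<in> space M. T n \<omega> = t \<and> T (Suc n) \<omega> = attach t v (Suc n)}"
  let ?A = "{\<omega> \<in> space M. T n \<omega> = t}"
  have "inj_on (\<lambda>v. attach t v (Suc n)) {..n}"
    using inj_on_attach[of t "Suc n"] recursive_tree[OF t] by simp
  then have "disjoint_family_on ?E {..n}"
    by (auto simp: disjoint_family_on_def inj_on_def)
  then have "prob (\<Union>v\<le>n. ?E v) = (\<Sum>v\<le>n. prob (?E v))"
    by (intro finite_measure_finite_Union) (auto intro: step_event)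
  also have "\<dots> = prob ?A"
    by (simp add: prob_step[OF t] sum_attach_prob del: times_divide_eq_right
        flip: sum_distrib_left)
  finally have "prob (?A - (\<Union>v\<le>n. ?E v)) = 0"
    by (subst finite_measure_Diff) (auto intro: tree_eq_event step_event)
  moreover have "?A - (\<Union>v\<le>n. ?E v) \<in> events"
    by (intro sets.Diff sets.finite_UN) (auto intro: tree_eq_event step_event)
  ultimately have "AE \<omega> in M. \<omega> \<notin> ?A - (\<Union>v\<le>n. ?E v)"
    by (intro AE_not_in) (simp add: null_sets_def emeasure_eq_measure)
  then show ?thesis
    by (rule AE_mp) (auto intro!: AE_I2)
qed

lemma AE_step:
  "AE \<omega> in M. T n \<omega> \<in> recursive_trees n \<longrightarrow>
     (\<exists>v\<le>n. T (Suc n) \<omega> = attach (T n \<omega>) v (Suc n))"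
proof -
  have "AE \<omega> in M. \<forall>t\<in>recursive_trees n.
      T n \<omega> = t \<longrightarrow> (\<exists>v\<le>n. T (Suc n) \<omega> = attach t v (Suc n))"
    by (intro AE_finite_allI finite_recursive_trees AE_step_from)
  then show ?thesis
    by (rule AE_mp) (auto intro!: AE_I2)
qed

lemma AE_history:
  "AE \<omega> in M. T 0 \<omega> = single_root 0 \<and>
     (\<forall>n. T n \<omega> \<in> recursive_trees n \<and> (\<exists>v\<le>n. T (Suc n) \<omega> = attach (T n \<omega>) v (Suc n)))"
proof -
  have "AE \<omega> in M. \<forall>n. T n \<omega> \<in> recursive_trees n \<longrightarrow>
     (\<exists>v\<le>n. T (Suc n) \<omega> = attach (T n \<omega>) v (Suc n))"
    using AE_step by (simp add: AE_all_countable)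
  with initial show ?thesis
  proof eventually_elim
    case (elim \<omega>)
    have "T n \<omega> \<in> recursive_trees n" for n
    proof (induction n)
      case (Suc n)
      then show ?case
        using elim(2) recursive_tree by fastforce
    qed (use elim in simp)
    then show ?case
      using elim by blast
  qed
qed

lemma AE_recursive_tree: "AE \<omega> in M. T n \<omega> \<in> recursive_trees n"
  using AE_history by (rule AE_mp) (auto intro!: AE_I2)

lemma AE_depth:
  "AE \<omega> in M. arrival_depth 0 \<omega> = 0 \<and>
     (\<forall>n. verts (T n \<omega>) = {..n} \<and> (\<forall>u\<le>n. depth (T n \<omega>) u = arrival_depth u \<omega>))"
  using AE_history
proof eventually_elim
  case (elim \<omega>)
  have "depth (T n \<omega>) u = arrival_depth u \<omega>" if "u \<le> n" for n u
    using that
  proof (induction n)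
    case (Suc n)
    obtain v where "v \<le> n" "T (Suc n) \<omega> = attach (T n \<omega>) v (Suc n)" "T n \<omega> \<in> recursive_trees n"
      using elim by blast
    then have "depth (T (Suc n) \<omega>) x = depth (T n \<omega>) x" if "x \<le> n" for x
      using recursive_tree[of "T n \<omega>" n] that by (simp add: depth_attach_old)
    then show ?case
      using Suc by (cases "u = Suc n") (auto simp: arrival_depth_def)
  qed (simp add: arrival_depth_def)
  moreover have "arrival_depth 0 \<omega> = 0"
    using depth_le[of "single_root 0" 0 0] elim by (simp add: arrival_depth_def single_root_def)
  ultimately show ?case
    using elim recursive_tree by blast
qed

section \<open>Expectations as finite sums over recursive trees\<close>

lemma integrable_tree_fun:
  fixes F :: "nat rooted_graph \<Rightarrow> real"
  shows "integrable M (\<lambda>\<omega>. F (T n \<omega>))"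
proof (rule integrable_const_bound)
  show "AE \<omega> in M. norm (F (T n \<omega>)) \<le> (\<Sum>t\<in>recursive_trees n. \<bar>F t\<bar>)"
    using AE_recursive_tree[of n]
  proof eventually_elim
    case (elim \<omega>)
    then show ?case
      using member_le_sum[of "T n \<omega>" "recursive_trees n" "\<lambda>t. \<bar>F t\<bar>"] finite_recursive_trees
      by simp
  qed
qed (rule measurable_tree_fun)

lemma expectation_tree_fun:
  fixes F :: "nat rooted_graph \<Rightarrow> real"
  shows "expectation (\<lambda>\<omega>. F (T n \<omega>)) = (\<Sum>t\<in>recursive_trees n. \<P>(\<omega> in M. T n \<omega> = t) * F t)"
proof -
  let ?E = "\<lambda>t. {\<omega> \<in> space M. T n \<omega> = t}"
  have "expectation (\<lambda>\<omega>. F (T n \<omega>))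
      = expectation (\<lambda>\<omega>. \<Sum>t\<in>recursive_trees n. F t * indicator (?E t) \<omega>)"
  proof (rule integral_cong_AE)
    show "AE \<omega> in M. F (T n \<omega>) = (\<Sum>t\<in>recursive_trees n. F t * indicator (?E t) \<omega>)"
      using AE_recursive_tree[of n] AE_space
    proof eventually_elim
      case (elim \<omega>)
      then show ?case
        using finite_recursive_trees
        by (simp add: indicator_def sum.delta' if_distrib cong: if_cong)
    qed
  qed (intro measurable_tree_fun borel_measurable_sum borel_measurable_times
      borel_measurable_indicator borel_measurable_const tree_eq_event)+
  also have "\<dots> = (\<Sum>t\<in>recursive_trees n. prob (?E t) * F t)"
    by (subst Bochner_Integration.integral_sum)
      (auto simp: tree_eq_event mult.commute emeasure_eq_measure
        intro!: integrable_mult_right integrable_real_indicator)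
  finally show ?thesis .
qed

text \<open>This one-step total expectation formula takes the place of conditional expectations
  given \<open>T n\<close>.\<close>

lemma expectation_tree_fun_Suc:
  fixes F :: "nat rooted_graph \<Rightarrow> real"
  shows "expectation (\<lambda>\<omega>. F (T (Suc n) \<omega>)) =
    (\<Sum>t\<in>recursive_trees n. \<P>(\<omega> in M. T n \<omega> = t) *
      (\<Sum>v\<le>n. f (depth t v) / total_weight f (depth t) n * F (attach t v (Suc n))))"
proof -
  let ?E = "\<lambda>t v. {\<omega> \<in> space M. T n \<omega> = t \<and> T (Suc n) \<omega> = attach t v (Suc n)}"
  have "expectation (\<lambda>\<omega>. F (T (Suc n) \<omega>)) = expectation (\<lambda>\<omega>.
      \<Sum>t\<in>recursive_trees n. \<Sum>v\<le>n. F (attach t v (Suc n)) * indicator (?E t v) \<omega>)"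
  proof (rule integral_cong_AE)
    show "AE \<omega> in M. F (T (Suc n) \<omega>) =
        (\<Sum>t\<in>recursive_trees n. \<Sum>v\<le>n. F (attach t v (Suc n)) * indicator (?E t v) \<omega>)"
      using AE_history AE_space
    proof eventually_elim
      case (elim \<omega>)
      then obtain v where v: "v \<le> n" "T (Suc n) \<omega> = attach (T n \<omega>) v (Suc n)"
        and t: "T n \<omega> \<in> recursive_trees n"
        by blast
      \<comment> \<open>Injectivity leaves exactly one nonzero term in the double sum, the one of
        the actual tree and parent.\<close>
      have inj: "attach (T n \<omega>) v (Suc n) = attach (T n \<omega>) u (Suc n) \<longleftrightarrow> u = v" if "u \<le> n" for u
        using inj_on_attach[of "T n \<omega>" "Suc n"] recursive_tree[OF t] that v(1)
        by (auto simp: inj_on_def)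
      have "F (attach t u (Suc n)) * indicator (?E t u) \<omega>
          = (if T n \<omega> = t then if u = v then F (attach t u (Suc n)) else 0 else 0)"
        if "u \<le> n" for t u
        using elim(2) v(2) inj[OF that] by (cases "T n \<omega> = t") auto
      then have "(\<Sum>t\<in>recursive_trees n. \<Sum>v\<le>n. F (attach t v (Suc n)) * indicator (?E t v) \<omega>)
          = (\<Sum>t\<in>recursive_trees n. if T n \<omega> = t then
              (\<Sum>u\<le>n. if u = v then F (attach t u (Suc n)) else 0) else 0)"
        by (intro sum.cong refl) auto
      also have "\<dots> = F (attach (T n \<omega>) v (Suc n))"
        using finite_recursive_trees t v(1) by (simp add: sum.delta sum.delta')
      finally show ?case
        using v(2) by simp
    qed
  qed (intro measurable_tree_fun borel_measurable_sum borel_measurable_times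
      borel_measurable_indicator borel_measurable_const step_event)+
  also have "\<dots> = (\<Sum>t\<in>recursive_trees n. \<Sum>v\<le>n. prob (?E t v) * F (attach t v (Suc n)))"
  proof -
    have "integrable M (\<lambda>\<omega>. F (attach t v (Suc n)) * indicator (?E t v) \<omega>)" for t v
      by (intro integrable_mult_right integrable_real_indicator step_event)
        (simp add: emeasure_eq_measure)
    then show ?thesis
      by (simp only: Bochner_Integration.integral_sum Bochner_Integration.integrable_sum)
        (simp add: step_event mult.commute)
  qed
  also have "\<dots> = (\<Sum>t\<in>recursive_trees n. \<P>(\<omega> in M. T n \<omega> = t) *
      (\<Sum>v\<le>n. f (depth t v) / total_weight f (depth t) n * F (attach t v (Suc n))))"
    by (intro sum.cong refl) (simp add: prob_step sum_distrib_left mult.assoc)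
  finally show ?thesis .
qed

section \<open>Maximal inequality for nonnegative supermartingales of the depths\<close>

context
  fixes X :: "nat \<Rightarrow> (nat \<Rightarrow> nat) \<Rightarrow> real"
  assumes nonneg: "\<And>n d. X n d \<ge> 0"
    and cong: "\<And>n d d'. (\<And>u. u \<le> n \<Longrightarrow> d u = d' u) \<Longrightarrow> X n d = X n d'"
    and super: "\<And>n d. (\<Sum>v\<le>n. f (d v) * X (Suc n) (d(Suc n := Suc (d v))))
      \<le> total_weight f d n * X n d"
begin

text \<open>A frozen process is constant in the new depth, giving equality; an unfrozen one
  coincides with \<open>X\<close> at this step.\<close>

lemma stopped_super:
  "(\<Sum>v\<le>n. f (d v) * stopped X a (Suc n) (d(Suc n := Suc (d v))))
    \<le> total_weight f d n * stopped X a n d"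
proof -
  have *: "stopped X a n (d(Suc n := k)) = stopped X a n d" for k
    by (intro stopped_cong cong) auto
  show ?thesis
  proof (cases "stopped X a n d \<ge> a")
    case True
    then show ?thesis
      by (simp add: * total_weight_def sum_distrib_right)
  next
    case False
    then show ?thesis
      using super[of d n] stopped_eq[of X a n d] by (simp add: *)
  qed
qed

lemma expectation_stopped_Suc:
  "expectation (\<lambda>\<omega>. stopped X a (Suc n) (depth (T (Suc n) \<omega>)))
    \<le> expectation (\<lambda>\<omega>. stopped X a n (depth (T n \<omega>)))"
proof -
  have "(\<Sum>v\<le>n. f (depth t v) / total_weight f (depth t) n *
      stopped X a (Suc n) (depth (attach t v (Suc n)))) \<le> stopped X a n (depth t)"
    if t: "t \<in> recursive_trees n" for t
  proof -
    have "stopped X a (Suc n) (depth (attach t v (Suc n)))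
        = stopped X a (Suc n) ((depth t)(Suc n := Suc (depth t v)))" if "v \<le> n" for v
      using recursive_tree[OF t] that
      by (intro stopped_cong cong) (auto simp: depth_attach_new depth_attach_old le_Suc_eq)
    then have "(\<Sum>v\<le>n. f (depth t v) / total_weight f (depth t) n *
      stopped X a (Suc n) (depth (attach t v (Suc n)))) =
      (\<Sum>v\<le>n. f (depth t v) * stopped X a (Suc n) ((depth t)(Suc n := Suc (depth t v))))
        / total_weight f (depth t) n"
      by (simp add: sum_divide_distrib)
    also have "\<dots> \<le> stopped X a n (depth t)"
      using stopped_super[where n = n and d = "depth t" and a = a] tree_weight_pos[where d = "depth t" and n = n]
      by (simp add: divide_le_eq mult.commute)
    finally show ?thesis .
  qed
  then show ?thesis
    unfolding expectation_tree_fun_Suc[of "\<lambda>t. stopped X a (Suc n) (depth t)"]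
      expectation_tree_fun[of "\<lambda>t. stopped X a n (depth t)"]
    by (intro sum_mono mult_left_mono) auto
qed

lemma expectation_stopped:
  "expectation (\<lambda>\<omega>. stopped X a n (depth (T n \<omega>))) \<le> expectation (\<lambda>\<omega>. X 0 (depth (T 0 \<omega>)))"
proof (induction n)
  case (Suc n)
  then show ?case
    by (rule order_trans[OF expectation_stopped_Suc])
qed simp

text \<open>Freezing makes the exceedance events increase with time, so up to time \<open>n\<close>
  only the last one matters. Markov's inequality and the nonincreasing expectation bound it
  uniformly in \<open>n\<close>.\<close>

lemma maximal_inequality:
  assumes "a > 0"
  shows "prob (\<Union>n. {\<omega> \<in> space M. stopped X a n (depth (T n \<omega>)) \<ge> a})
    \<le> expectation (\<lambda>\<omega>. X 0 (depth (T 0 \<omega>))) / a"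
proof -
  let ?N = "\<lambda>n. {\<omega> \<in> space M. stopped X a n (depth (T n \<omega>)) \<ge> a}"
  let ?K = "expectation (\<lambda>\<omega>. X 0 (depth (T 0 \<omega>)))"
  have N: "?N n \<in> events" for n
    using tree_event[of n "{t. stopped X a n (depth t) \<ge> a}"] by simp
  have finite_bound: "prob (\<Union>i\<le>n. ?N i) \<le> ?K / a" for n
  proof -
    \<comment> \<open>The inclusion is only almost sure, since depths at different times are read in
      different trees.\<close>
    have "AE \<omega> in M. \<omega> \<in> (\<Union>i\<le>n. ?N i) \<longrightarrow> \<omega> \<in> ?N n"
      using AE_depth
    proof eventually_elim
      case (elim \<omega>)
      have "stopped X a i (depth (T i \<omega>)) = stopped X a i (\<lambda>u. arrival_depth u \<omega>)" for i
        using elim by (intro stopped_cong cong) auto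
      then show ?case
        using stopped_ge_mono[of _ n a X "\<lambda>u. arrival_depth u \<omega>"] by auto
    qed
    then have "prob (\<Union>i\<le>n. ?N i) \<le> prob (?N n)"
      using N by (intro finite_measure_mono_AE) auto
    also have "\<dots> \<le> expectation (\<lambda>\<omega>. stopped X a n (depth (T n \<omega>))) / a"
      using assms stopped_nonneg nonneg
      by (intro integral_Markov_inequality_measure[where A = "{}"]
          integrable_tree_fun[of "\<lambda>t. stopped X a n (depth t)"]) auto
    also have "\<dots> \<le> ?K / a"
      using expectation_stopped assms by (intro divide_right_mono) auto
    finally show ?thesis .
  qed
  have "(\<lambda>n. prob (\<Union>i\<le>n. ?N i)) \<longlonglongrightarrow> prob (\<Union>n. \<Union>i\<le>n. ?N i)"
    using N by (intro finite_Lim_measure_incseq) (force simp: incseq_def)+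
  then have "prob (\<Union>n. \<Union>i\<le>n. ?N i) \<le> ?K / a"
    by (rule LIMSEQ_le_const2) (use finite_bound in auto)
  moreover have "(\<Union>n. \<Union>i\<le>n. ?N i) = (\<Union>n. ?N n)"
    by auto
  ultimately show ?thesis
    by simp
qed

text \<open>Reaching every level has probability at most \<open>?K / (m + 1)\<close> for each
  \<open>m\<close>, hence zero.\<close>

theorem supermartingale_bounded: "AE \<omega> in M. \<exists>C. \<forall>n. X n (\<lambda>u. arrival_depth u \<omega>) \<le> C"
proof -
  let ?N = "\<lambda>a n. {\<omega> \<in> space M. stopped X a n (depth (T n \<omega>)) \<ge> a}"
  let ?K = "expectation (\<lambda>\<omega>. X 0 (depth (T 0 \<omega>)))"
  let ?U = "\<Inter>m. \<Union>n. ?N (real (Suc m)) n"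
  have N: "?N a n \<in> events" for a n
    using tree_event[of n "{t. stopped X a n (depth t) \<ge> a}"] by simp
  have "prob ?U \<le> ?K / real (Suc m)" for m
  proof -
    have "prob ?U \<le> prob (\<Union>n. ?N (real (Suc m)) n)"
      using N by (intro finite_measure_mono) auto
    also have "\<dots> \<le> ?K / real (Suc m)"
      by (rule maximal_inequality) simp
    finally show ?thesis .
  qed
  moreover have "(\<lambda>m. ?K / real (Suc m)) \<longlonglongrightarrow> 0"
    using LIMSEQ_Suc[OF lim_const_over_n] by blast
  ultimately have "prob ?U \<le> 0"
    by (meson LIMSEQ_le_const)
  then have "prob ?U = 0"
    by (simp add: measure_le_0_iff)
  moreover have "?U \<in> events"
    using N by auto
  ultimately have "AE \<omega> in M. \<omega> \<notin> ?U"
    by (intro AE_not_in) (simp add: null_sets_def emeasure_eq_measure)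
  with AE_depth AE_space show ?thesis
  proof eventually_elim
    case (elim \<omega>)
    \<comment> \<open>Some level is never reached, so there the stopped process is \<open>X\<close>
      itself and that level is a bound.\<close>
    then obtain m where m: "\<And>n. stopped X (real (Suc m)) n (depth (T n \<omega>)) < real (Suc m)"
      by (auto simp: not_le)
    have "X n (\<lambda>u. arrival_depth u \<omega>) \<le> real (Suc m)" for n
    proof -
      have "stopped X (real (Suc m)) n (depth (T n \<omega>)) = X n (depth (T n \<omega>))"
        using m by (intro stopped_eq)
      also have "\<dots> = X n (\<lambda>u. arrival_depth u \<omega>)"
        using elim by (intro cong) auto
      finally show ?thesis
        using m[of n] by simp
    qed
    then show ?case by blast
  qed
qed

end

lemma mass_bounded:
  assumes "\<beta> > 0"
  shows "AE \<omega> in M. \<exists>C. \<forall>n. mass f \<beta> (\<lambda>u. arrival_depth u \<omega>) n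
    * exp (- \<beta> * clock f (\<lambda>u. arrival_depth u \<omega>) n) \<le> C"
proof (rule supermartingale_bounded[where X = "\<lambda>n d. mass f \<beta> d n * exp (- \<beta> * clock f d n)"])
  fix n and d d' :: "nat \<Rightarrow> nat"
  assume "\<And>u. u \<le> n \<Longrightarrow> d u = d' u"
  then have "mass f \<beta> d n = mass f \<beta> d' n" "clock f d n = clock f d' n"
    by (auto intro: mass_cong clock_cong weight_pos)
  then show "mass f \<beta> d n * exp (- \<beta> * clock f d n) = mass f \<beta> d' n * exp (- \<beta> * clock f d' n)"
    by simp
qed (auto simp: less_imp_le[OF mass_pos] weight_pos assms
    intro: mass_supermartingale[of f \<beta>, simplified])

lemma inverse_mass_bounded:
  assumes "\<beta> > 0" "\<And>k. tilt f \<beta> k \<le> G"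
  shows "AE \<omega> in M. \<exists>C. \<forall>n. exp (\<beta> * slow_clock f \<beta> G (\<lambda>u. arrival_depth u \<omega>) n)
    / mass f \<beta> (\<lambda>u. arrival_depth u \<omega>) n \<le> C"
proof (rule supermartingale_bounded[where
      X = "\<lambda>n d. exp (\<beta> * slow_clock f \<beta> G d n) / mass f \<beta> d n"])
  fix n and d d' :: "nat \<Rightarrow> nat"
  assume "\<And>u. u \<le> n \<Longrightarrow> d u = d' u"
  then have "mass f \<beta> d n = mass f \<beta> d' n" "slow_clock f \<beta> G d n = slow_clock f \<beta> G d' n"
    by (auto intro: mass_cong slow_clock_cong weight_pos)
  then show "exp (\<beta> * slow_clock f \<beta> G d n) / mass f \<beta> d n
      = exp (\<beta> * slow_clock f \<beta> G d' n) / mass f \<beta> d' n"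
    by simp
qed (auto simp: less_imp_le[OF mass_pos] weight_pos assms
    intro: inverse_mass_supermartingale[of f \<beta>, simplified])

end

section \<open>Depth of typical vertices\<close>

definition typical_vertices :: "real \<Rightarrow> nat \<Rightarrow> nat rooted_graph \<Rightarrow> nat set" where
  "typical_vertices \<epsilon> n t = {v \<in> verts t. (1 - \<epsilon>) * ln (real n) \<le> real (depth t v) \<and>
     real (depth t v) \<le> (1 + \<epsilon>) * ln (real n)}"

context depth_weighted_rrt
begin

theorem AE_typical_vertices:
  assumes mean_ln: "(\<lambda>n. (\<Sum>k<n. ln (f k)) / real n) \<longlonglongrightarrow> 0" and "\<epsilon> > 0"
  shows "AE \<omega> in M. (\<lambda>n. real (card (typical_vertices \<epsilon> n (T n \<omega>))) / real n) \<longlonglongrightarrow> 1"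
proof -
  \<comment> \<open>Rational \<open>\<beta>\<close> and natural \<open>G\<close> leave countably
    many almost sure bounds, so one null set serves them all.\<close>
  let ?d = "\<lambda>\<omega> u. arrival_depth u \<omega>" and ?Q = "{\<beta>\<in>\<rat>. \<beta> > (0::real)}"
  have Q: "countable ?Q"
    using countable_rat by (rule countable_subset[rotated]) auto
  have upper: "AE \<omega> in M. \<forall>\<beta>\<in>?Q. \<exists>C. \<forall>n. mass f \<beta> (?d \<omega>) n * exp (- \<beta> * clock f (?d \<omega>) n) \<le> C"
    unfolding AE_ball_countable[OF Q] using mass_bounded by blast
  \<comment> \<open>The premise on \<open>G\<close> is deterministic, so the implication is trivial
    when it fails.\<close>
  have "AE \<omega> in M. (\<forall>k. tilt f \<beta> k \<le> real G) \<longrightarrow>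
      (\<exists>C. \<forall>n. exp (\<beta> * slow_clock f \<beta> (real G) (?d \<omega>) n) / mass f \<beta> (?d \<omega>) n \<le> C)"
    if "\<beta> \<in> ?Q" for \<beta> G
    using inverse_mass_bounded[of \<beta> "real G"] that by (cases "\<forall>k. tilt f \<beta> k \<le> real G") auto
  then have lower: "AE \<omega> in M. \<forall>\<beta>\<in>?Q. \<forall>G. (\<forall>k. tilt f \<beta> k \<le> real G) \<longrightarrow>
      (\<exists>C. \<forall>n. exp (\<beta> * slow_clock f \<beta> (real G) (?d \<omega>) n) / mass f \<beta> (?d \<omega>) n \<le> C)"
    unfolding AE_ball_countable[OF Q] AE_all_countable by blast
  show ?thesis
    using AE_depth upper lower
  proof eventually_elim
    case (elim \<omega>)
    have "typical_vertices \<epsilon> n (T n \<omega>) = {u\<in>{..n}. (1 - \<epsilon>) * ln (real n) \<le> real (?d \<omega> u) \<and>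
        real (?d \<omega> u) \<le> (1 + \<epsilon>) * ln (real n)}" for n
      using elim(1) by (auto simp: typical_vertices_def)
    then show ?case
      using typical_fraction[OF weight_pos mean_ln _ _ _ assms(2), of "?d \<omega>"] elim by simp
  qed
qed

section \<open>From vertex counts to a uniform random vertex\<close>

lemma expectation_typical_vertices:
  assumes "(\<lambda>n. (\<Sum>k<n. ln (f k)) / real n) \<longlonglongrightarrow> 0" and "\<epsilon> > 0"
  shows "(\<lambda>n. expectation (\<lambda>\<omega>. real (card (typical_vertices \<epsilon> n (T n \<omega>))) / real (Suc n))) \<longlonglongrightarrow> 1"
proof -
  have "(\<lambda>n. expectation (\<lambda>\<omega>. real (card (typical_vertices \<epsilon> n (T n \<omega>))) / real (Suc n)))
      \<longlonglongrightarrow> expectation (\<lambda>\<omega>. 1)"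
  proof (rule integral_dominated_convergence[where w = "\<lambda>\<omega>. 1"])
    show "(\<lambda>\<omega>. real (card (typical_vertices \<epsilon> n (T n \<omega>))) / real (Suc n)) \<in> borel_measurable M" for n
      by (rule measurable_tree_fun[of "\<lambda>t. real (card (typical_vertices \<epsilon> n t)) / real (Suc n)"])
    show "AE \<omega> in M. norm (real (card (typical_vertices \<epsilon> n (T n \<omega>))) / real (Suc n)) \<le> 1" for n
      using AE_depth
    proof eventually_elim
      case (elim \<omega>)
      then have "card (typical_vertices \<epsilon> n (T n \<omega>)) \<le> card {..n}"
        by (intro card_mono) (auto simp: typical_vertices_def)
      then show ?case by simp
    qed
    show "AE \<omega> in M. (\<lambda>n. real (card (typical_vertices \<epsilon> n (T n \<omega>))) / real (Suc n)) \<longlonglongrightarrow> 1"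
      using AE_typical_vertices[OF assms]
    proof eventually_elim
      case (elim \<omega>)
      \<comment> \<open>The tree has \<open>n + 1\<close> vertices; this factor converts the
        normalisation by \<open>n\<close> into a genuine proportion.\<close>
      have "(\<lambda>n. real n / real (Suc n)) \<longlonglongrightarrow> 1"
        by real_asymp
      from tendsto_mult[OF elim this]
      have "(\<lambda>n. real (card (typical_vertices \<epsilon> n (T n \<omega>))) / real n * (real n / real (Suc n)))
          \<longlonglongrightarrow> 1"
        by simp
      then show ?case
        by (rule Lim_transform_eventually)
          (rule eventually_mono[OF eventually_gt_at_top[of 0]], simp)
    qed
  qed auto
  then show ?thesis
    by (simp add: prob_space)
qed

text \<open>Each typical pair of a tree \<open>t\<close> and a vertex has joint probability
  \<open>prob (T n = t) / (n + 1)\<close>. Summing these disjoint events gives the expected typical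
  proportion, and \<open>A\<close> lies in the complement.\<close>

lemma uniform_vertex_atypical:
  assumes V: "uniform_vertex_given M (T n) V"
    and A: "\<And>\<omega>. \<omega> \<in> A \<Longrightarrow> \<omega> \<in> space M \<and> V \<omega> \<notin> typical_vertices \<epsilon> n (T n \<omega>)"
  shows "prob A \<le> 1 - expectation (\<lambda>\<omega>. real (card (typical_vertices \<epsilon> n (T n \<omega>))) / real (Suc n))"
proof -
  let ?E = "\<lambda>(t, v). {\<omega> \<in> space M. V \<omega> = v \<and> T n \<omega> = t}"
  let ?I = "Sigma (recursive_trees n) (typical_vertices \<epsilon> n)"
  have fin_typical: "finite (typical_vertices \<epsilon> n t)" if "t \<in> recursive_trees n" for t
    using recursive_tree[OF that] by (simp add: typical_vertices_def)
  then have fin: "finite ?I"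
    using finite_recursive_trees by auto
  have "V -` {v} \<inter> space M \<in> events" for v
    using V by (intro measurable_sets) (auto simp: uniform_vertex_given_def)
  then have "(V -` {v} \<inter> space M) \<inter> {\<omega> \<in> space M. T n \<omega> = t} \<in> events" for v t
    using tree_eq_event by blast
  moreover have "(V -` {v} \<inter> space M) \<inter> {\<omega> \<in> space M. T n \<omega> = t} = ?E (t, v)" for v t
    by auto
  ultimately have E: "?E i \<in> events" for i
    by (cases i) simp
  have prob_E: "prob (?E (t, v)) = \<P>(\<omega> in M. T n \<omega> = t) * (1 / real (Suc n))"
    if t: "t \<in> recursive_trees n" and v: "v \<in> typical_vertices \<epsilon> n t" for t v
  proof (cases "\<P>(\<omega> in M. T n \<omega> = t) = 0")
    case True
    have "prob (?E (t, v)) \<le> \<P>(\<omega> in M. T n \<omega> = t)"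
      by (intro finite_measure_mono) (auto intro: tree_eq_event)
    then show ?thesis
      using True by (simp add: measure_le_0_iff)
  next
    case False
    then have "\<P>(\<omega> in M. T n \<omega> = t) > 0"
      by (simp add: zero_less_measure_iff)
    moreover have "v \<in> verts t" "card (verts t) = Suc n"
      using v recursive_tree[OF t] by (auto simp: typical_vertices_def)
    ultimately have "\<P>(\<omega> in M. V \<omega> = v \<bar> T n \<omega> = t) = 1 / real (Suc n)"
      using V by (auto simp: uniform_vertex_given_def)
    then show ?thesis
      using False by (simp add: cond_prob_def field_simps)
  qed
  have "prob A \<le> prob (space M - (\<Union>i\<in>?I. ?E i))"
    using fin E A by (intro finite_measure_mono sets.Diff sets.finite_UN) auto
  also have "\<dots> = 1 - prob (\<Union>i\<in>?I. ?E i)"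
    using fin E by (intro prob_compl sets.finite_UN) auto
  also have "prob (\<Union>i\<in>?I. ?E i) = (\<Sum>i\<in>?I. prob (?E i))"
    using fin E by (intro finite_measure_finite_Union) (auto simp: disjoint_family_on_def)
  also have "\<dots> = (\<Sum>t\<in>recursive_trees n. \<Sum>v\<in>typical_vertices \<epsilon> n t. prob (?E (t, v)))"
    using fin_typical finite_recursive_trees by (subst sum.Sigma) (auto intro!: sum.cong)
  also have "\<dots> = (\<Sum>t\<in>recursive_trees n.
      \<P>(\<omega> in M. T n \<omega> = t) * (real (card (typical_vertices \<epsilon> n t)) / real (Suc n)))"
    using prob_E by (intro sum.cong refl) simp
  also have "\<dots> = expectation (\<lambda>\<omega>. real (card (typical_vertices \<epsilon> n (T n \<omega>))) / real (Suc n))"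
    by (rule expectation_tree_fun[symmetric])
  finally show ?thesis .
qed

theorem uniform_vertex_depth:
  assumes "(\<lambda>n. (\<Sum>k<n. ln (f k)) / real n) \<longlonglongrightarrow> 0"
    and V: "\<And>n. uniform_vertex_given M (T n) (V n)"
  shows "tendsto_in_probability M (\<lambda>n \<omega>. real (depth (T n \<omega>) (V n \<omega>)) / ln (real n)) 1"
  unfolding tendsto_in_probability_def
proof (intro allI impI)
  fix \<epsilon> :: real assume \<epsilon>: "\<epsilon> > 0"
  let ?p = "\<lambda>n. \<P>(\<omega> in M. \<bar>real (depth (T n \<omega>) (V n \<omega>)) / ln (real n) - 1\<bar> > \<epsilon>)"
  let ?e = "\<lambda>n. expectation (\<lambda>\<omega>. real (card (typical_vertices \<epsilon> n (T n \<omega>))) / real (Suc n))"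
  \<comment> \<open>For \<open>n > 1\<close> the logarithm is positive, so a relative deviation
    above \<open>\<epsilon>\<close> means that the vertex is atypical.\<close>
  have "?p n \<le> 1 - ?e n" if "n > 1" for n
  proof -
    have "ln (real n) > 0" using that by simp
    then have "V n \<omega> \<notin> typical_vertices \<epsilon> n (T n \<omega>)"
      if "\<bar>real (depth (T n \<omega>) (V n \<omega>)) / ln (real n) - 1\<bar> > \<epsilon>" for \<omega>
      using that by (auto simp: typical_vertices_def abs_if field_simps split: if_splits)
    then show ?thesis
      by (intro uniform_vertex_atypical[OF V]) auto
  qed
  then have "\<forall>\<^sub>F n in sequentially. norm (?p n) \<le> 1 - ?e n"
    by (intro eventually_mono[OF eventually_gt_at_top[of 1]]) auto
  moreover have "(\<lambda>n. 1 - ?e n) \<longlonglongrightarrow> 0"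
    using tendsto_diff[OF tendsto_const[of 1] expectation_typical_vertices[OF assms(1) \<epsilon>]] by simp
  ultimately show "?p \<longlonglongrightarrow> 0"
    by (rule Lim_null_comparison)
qed

end

theorem theorem1p3:
  fixes M :: "'a measure" and f :: "nat \<Rightarrow> real" and T :: "nat \<Rightarrow> 'a \<Rightarrow> nat rooted_graph"
  assumes "depth_weighted_rrt M f T"
    and "\<exists>c>0. \<forall>n. c \<le> f n \<and> f n \<le> 1 / c"
    and "(\<lambda>n. (\<Sum>k<n. ln (f k)) / real n) \<longlonglongrightarrow> 0"
  shows "(\<forall>V :: nat \<Rightarrow> 'a \<Rightarrow> nat. (\<forall>n. uniform_vertex_given M (T n) (V n)) \<longrightarrow>
            tendsto_in_probability M (\<lambda>n \<omega>. real (depth (T n \<omega>) (V n \<omega>)) / ln (real n)) 1)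
       \<and> (\<forall>\<epsilon>>0. AE \<omega> in M.
            (\<lambda>n. real (card {v \<in> verts (T n \<omega>).
                     (1 - \<epsilon>) * ln (real n) \<le> real (depth (T n \<omega>) v) \<and>
                     real (depth (T n \<omega>) v) \<le> (1 + \<epsilon>) * ln (real n)}) / real n) \<longlonglongrightarrow> 1)"
  using depth_weighted_rrt.uniform_vertex_depth[OF assms(1,3)]
    depth_weighted_rrt.AE_typical_vertices[OF assms(1,3)]
  by (simp add: typical_vertices_def)

end
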